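(* Let $n\ge 359$ be an integer and let $a$ be the unique positive odd integer such that $a^2-2\le n\le (a+2)^2-3$. Suppose that $X\subset\mathbb{S}^{n-1}$ is an equiangular set of size $\frac{(a^2-2)(a^2-1)}{2}$. Then $X$ has scalar products $\frac1a,-\frac1a$ (i.e. the scalar product of any two distinct points of $X$ belongs to $\{\frac1a,-\frac1a\}$), and $X$ is contained in an $(a^2-2)$-dimensional linear subspace of $\mathbb{R}^n$.
   Context: $\mathbb{S}^{n-1}$ denotes the unit sphere in $\mathbb{R}^n$. An equiangular set in $\mathbb{S}^{n-1}$ is a finite set $X\subset\mathbb{S}^{n-1}$ for which there is $\alpha\in[0,1)$ such that the scalar product of any two distinct points of $X$ belongs to $\{\alpha,-\alpha\}$. *)

theory Defs
  imports "HOL-Analysis.Analysis"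
begin

definition equiangular_set :: "'a::real_inner set \<Rightarrow> bool" where
  "equiangular_set X \<longleftrightarrow>
     finite X \<and> X \<subseteq> sphere 0 1 \<and>
     (\<exists>\<alpha>::real. 0 \<le> \<alpha> \<and> \<alpha> < 1 \<and> (\<forall>x\<in>X. \<forall>y\<in>X. x \<noteq> y \<longrightarrow> x \<bullet> y \<in> {\<alpha>, -\<alpha>}))"

end

theory Submission
  imports Defs "Jordan_Normal_Form.Char_Poly" "HOL-Library.Z2"
begin

text \<open>
  Let \<open>N = |X|\<close> and let \<open>\<plusminus>1/b\<close> be the inner products of \<open>X\<close>. The Seidel matrix of \<open>X\<close> is an integer
  matrix with eigenvalue \<open>- b\<close> of multiplicity at least \<open>N - n\<close>, so \<open>N > 2 n\<close> forces \<open>b\<close> to be an odd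
  integer. If \<open>b \<ge> a + 2\<close>, then \<open>N\<close> violates the relative bound. If \<open>n\<close> is at most about \<open>3 b\<^sup>2\<close>,
  projecting \<open>X\<close> from one of its points and testing with harmonic polynomials of degrees 1 and 3 yields
  \<open>N \<le> (b\<^sup>2 - 1) (b\<^sup>2 - 2) / 2\<close>; for \<open>b = a\<close> equality holds, so the degree 1 sums vanish, \<open>X\<close> is a
  tight frame of its span, and the dimension of the span is read off from the trace of the frame operator.
  If \<open>b\<close> is smaller than that, then Bessel's inequality for the matrices \<open>z z\<^sup>T\<close> shows
  that the Gram matrix has an eigenvalue close to \<open>N / b\<close> carrying almost all of its Hilbert--Schmidt norm,
  and the Cauchy--Schwarz inequality for the remaining eigenvalues bounds \<open>N\<close> by about
  \<open>n b\<^sup>4 / (2 (b - 1)\<^sup>2)\<close>, which is less than \<open>(a\<^sup>2 - 1) (a\<^sup>2 - 2) / 2\<close>.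
\<close>

section \<open>Integrality of the inverse angle\<close>

text \<open>Both sides are the determinant of the block matrix \<open>?M\<close>: clearing its lower
  left block with \<open>?L\<close> gives the left side, the factorisation
  \<open>?D * (?U * ?V)\<close> the right side. Nothing is divided, so \<open>p\<close> may be a
  polynomial.\<close>

lemma det_sylvester:
  fixes A B :: "'a::idom Matrix.mat"
  assumes A: "A \<in> carrier_mat N n" and B: "B \<in> carrier_mat n N"
  shows "p ^ n * Determinant.det (p \<cdot>\<^sub>m 1\<^sub>m N - A * B) = p ^ N * Determinant.det (p \<cdot>\<^sub>m 1\<^sub>m n - B * A)"
proof -
  let ?L = "four_block_mat (1\<^sub>m n) (0\<^sub>m n N) (- A) (1\<^sub>m N)"
  let ?D = "four_block_mat (1\<^sub>m n) (0\<^sub>m n N) (0\<^sub>m N n) (p \<cdot>\<^sub>m 1\<^sub>m N)"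
  let ?U = "four_block_mat (p \<cdot>\<^sub>m 1\<^sub>m n - B * A) B (0\<^sub>m N n) (1\<^sub>m N)"
  let ?V = "four_block_mat (1\<^sub>m n) (0\<^sub>m n N) A (1\<^sub>m N)"
  let ?M = "four_block_mat (p \<cdot>\<^sub>m 1\<^sub>m n) B (p \<cdot>\<^sub>m A) (p \<cdot>\<^sub>m 1\<^sub>m N)"
  have M: "?M \<in> carrier_mat (n + N) (n + N)" and L: "?L \<in> carrier_mat (n + N) (n + N)"
    using assms by auto
  have pA: "- A * (p \<cdot>\<^sub>m 1\<^sub>m n) = - (p \<cdot>\<^sub>m A)" "- A * B = - (A * B)" "p \<cdot>\<^sub>m 1\<^sub>m N * A = p \<cdot>\<^sub>m A"
    using A B by (auto intro!: eq_matI)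
  have LM: "?L * ?M = four_block_mat (p \<cdot>\<^sub>m 1\<^sub>m n) B (0\<^sub>m N n) (p \<cdot>\<^sub>m 1\<^sub>m N - A * B)"
    using assms pA
    by (subst mult_four_block_mat[where ?n1.0=n and ?n2.0=N and ?nr1.0=n and ?nr2.0=N]) auto
  have UV: "?U * ?V = four_block_mat (p \<cdot>\<^sub>m 1\<^sub>m n) B A (1\<^sub>m N)"
    using assms
    by (subst mult_four_block_mat[where ?n1.0=n and ?n2.0=N and ?nr1.0=n and ?nr2.0=N])
      (auto intro!: cong_four_block_mat eq_matI)
  have DUV: "?D * (?U * ?V) = ?M"
    unfolding UV
    using assms pA
    by (subst mult_four_block_mat[where ?n1.0=n and ?n2.0=N and ?nr1.0=n and ?nr2.0=N]) auto
  have "Determinant.det ?M = p ^ n * Determinant.det (p \<cdot>\<^sub>m 1\<^sub>m N - A * B)"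
  proof -
    have "Determinant.det ?M = Determinant.det (?L * ?M)"
      using det_mult[OF L M] assms det_four_block_mat_upper_right_zero[of "1\<^sub>m n" n _ N "-A" "1\<^sub>m N"] by simp
    also have "\<dots> = p ^ n * Determinant.det (p \<cdot>\<^sub>m 1\<^sub>m N - A * B)"
      unfolding LM using assms
      by (subst det_four_block_mat_lower_left_zero[where n=n and m=N]) auto
    finally show ?thesis .
  qed
  moreover have "Determinant.det ?M = p ^ N * Determinant.det (p \<cdot>\<^sub>m 1\<^sub>m n - B * A)"
  proof -
    have D: "?D \<in> carrier_mat (n + N) (n + N)" and U: "?U \<in> carrier_mat (n + N) (n + N)"
      and V: "?V \<in> carrier_mat (n + N) (n + N)"
      using assms by auto
    have "Determinant.det ?M = Determinant.det ?D * (Determinant.det ?U * Determinant.det ?V)"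
      unfolding DUV[symmetric] using det_mult[OF D mult_carrier_mat[OF U V]] det_mult[OF U V] by simp
    also have "Determinant.det ?D = p ^ N"
      by (subst det_four_block_mat_upper_right_zero[where n=n and m=N]) auto
    also have "Determinant.det ?U = Determinant.det (p \<cdot>\<^sub>m 1\<^sub>m n - B * A)"
      using assms by (subst det_four_block_mat_lower_left_zero[where n=n and m=N]) auto
    also have "Determinant.det ?V = 1"
      using assms by (subst det_four_block_mat_upper_right_zero[where n=n and m=N]) auto
    finally show ?thesis by simp
  qed
  ultimately show ?thesis by simp
qed

text \<open>The determinant identity over the polynomial ring, with \<open>p = [:b, 1:]\<close>:
  cancelling \<open>p ^ n\<close> turns the rank bound on \<open>S + b I\<close> into an algebraic
  multiplicity of the root \<open>- b\<close>.\<close>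

lemma char_poly_low_rank:
  fixes S :: "'a::idom Matrix.mat"
  assumes A: "A \<in> carrier_mat N n" and B: "B \<in> carrier_mat n N" and "n \<le> N"
    and S: "S \<in> carrier_mat N N" and SAB: "S + b \<cdot>\<^sub>m 1\<^sub>m N = A * B"
  shows "[:b, 1:] ^ (N - n) dvd char_poly S"
proof -
  let ?c = "map_mat (\<lambda>c. [:c:])"
  interpret c: comm_ring_hom "\<lambda>c::'a. [:c:]" by unfold_locales auto
  have AB: "?c A * ?c B = ?c S + [:b:] \<cdot>\<^sub>m 1\<^sub>m N"
    unfolding c.mat_hom_mult[OF A B, symmetric] SAB[symmetric]
    using S by (intro eq_matI) auto
  have "[:b, 1:] \<cdot>\<^sub>m 1\<^sub>m N - ?c A * ?c B = char_poly_matrix S"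
    unfolding AB char_poly_matrix_def using S by (intro eq_matI) auto
  then have "[:b, 1:] ^ n * char_poly S = [:b, 1:] ^ n * ([:b, 1:] ^ (N - n) * Determinant.det ([:b, 1:] \<cdot>\<^sub>m 1\<^sub>m n - ?c B * ?c A))"
    using det_sylvester[of "?c A" N n "?c B" "[:b,1:]"] A B \<open>n \<le> N\<close>
    unfolding char_poly_def by (simp flip: mult.assoc power_add)
  then show ?thesis by simp
qed

text \<open>An irrational root has a minimal polynomial of degree at least 2, which is separable.\<close>

lemma order_le_degree_irrational:
  fixes p :: "rat poly" and x :: real
  assumes "p \<noteq> 0" and "x \<notin> \<rat>"
  shows "2 * order x (map_poly of_rat p) \<le> Polynomial.degree p"
  using assms(1)
proof (induction "Polynomial.degree p" arbitrary: p rule: less_induct)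
  case less
  let ?h = "map_poly (of_rat :: rat \<Rightarrow> real)"
  interpret h: map_poly_inj_idom_hom "of_rat :: rat \<Rightarrow> real" ..
  show ?case
  proof (cases "order x (?h p) = 0")
    case False
    then have root: "poly (?h p) x = 0"
      by (metis order_root order_0I)
    define q where "q = arg_min Polynomial.degree (\<lambda>q. q \<noteq> 0 \<and> poly (?h q) x = 0)"
    have q: "q \<noteq> 0" "poly (?h q) x = 0"
      using arg_min_natI[of "\<lambda>q. q \<noteq> 0 \<and> poly (?h q) x = 0" p Polynomial.degree] less.prems root
      unfolding q_def by auto
    have qmin: "Polynomial.degree q \<le> Polynomial.degree r" if "r \<noteq> 0" "poly (?h r) x = 0" for r
      using arg_min_nat_le[of "\<lambda>q. q \<noteq> 0 \<and> poly (?h q) x = 0" r Polynomial.degree] that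
      unfolding q_def by auto
    have "Polynomial.degree q \<noteq> 0"
    proof
      assume "Polynomial.degree q = 0"
      then obtain c where "q = [:c:]" using degree_eq_zeroE by blast
      with q show False by simp
    qed
    moreover have "Polynomial.degree q \<noteq> 1"
    proof
      assume "Polynomial.degree q = 1"
      then obtain c d where cd: "q = [:c, d:]" "d \<noteq> 0"
        by (metis degree1_coeffs)
      then have "of_rat c + x * of_rat d = 0"
        using q by simp
      then have "x = of_rat (- c / d)"
        using cd by (simp add: of_rat_divide of_rat_minus field_simps)
      with assms(2) show False by auto
    qed
    ultimately have dq: "Polynomial.degree q \<ge> 2" by linarith
    have oq: "order x (?h q) \<le> 1"
    proof (rule ccontr)
      assume "\<not> order x (?h q) \<le> 1"
      moreover have "?h q \<noteq> 0" "pderiv (?h q) \<noteq> 0"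
        using q dq by (auto simp: pderiv_eq_0_iff)
      ultimately have "poly (?h (pderiv q)) x = 0"
        using order_pderiv[of "?h q" x] by (auto simp: order_root of_rat_hom.map_poly_pderiv)
      moreover have "pderiv q \<noteq> 0" using dq by (auto simp: pderiv_eq_0_iff)
      ultimately have "Polynomial.degree q \<le> Polynomial.degree (pderiv q)" by (intro qmin)
      then show False using dq by (simp add: degree_pderiv)
    qed
    \<comment> \<open>By minimality the remainder vanishes. Passing from \<open>p\<close> to
      \<open>s\<close> lowers the order of \<open>x\<close> by at most 1 and the degree by at least
      2.\<close>
    define s r where "s = p div q" and "r = p mod q"
    have "r = 0"
    proof (rule ccontr)
      assume "r \<noteq> 0"
      have "p = s * q + r" unfolding s_def r_def by simp
      then have "?h p = ?h s * ?h q + ?h r" by (simp add: h.hom_add h.hom_mult)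
      then have "poly (?h r) x = 0" using root q by simp
      with qmin \<open>r \<noteq> 0\<close> have "Polynomial.degree q \<le> Polynomial.degree r" by simp
      then show False using \<open>r \<noteq> 0\<close> degree_mod_less[of q p] q unfolding r_def by simp
    qed
    have ps: "p = q * s" using \<open>r = 0\<close> unfolding r_def s_def by auto
    then have "s \<noteq> 0" using less.prems by auto
    then have deg: "Polynomial.degree p = Polynomial.degree q + Polynomial.degree s"
      using ps q by (simp add: degree_mult_eq)
    have "2 * order x (?h s) \<le> Polynomial.degree s"
      using deg dq \<open>s \<noteq> 0\<close> by (intro less.hyps) auto
    moreover have "order x (?h p) = order x (?h q) + order x (?h s)"
      unfolding ps using q \<open>s \<noteq> 0\<close> by (simp add: h.hom_mult order_mult)
    ultimately show ?thesis using oq deg dq by linarith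
  qed simp
qed

text \<open>Modulo 2 the matrix becomes \<open>J\<close>, all ones minus the identity. For even
  \<open>N\<close> it is its own inverse, whereas an even root \<open>k\<close> would make it
  singular.\<close>

lemma Seidel_mod_2:
  fixes S :: "int Matrix.mat"
  assumes S: "S \<in> carrier_mat N N" and "even N" "even k"
    and odd: "\<And>i j. i < N \<Longrightarrow> j < N \<Longrightarrow> odd (S $$ (i,j)) \<longleftrightarrow> i \<noteq> j"
  shows "poly (char_poly S) k \<noteq> 0"
proof
  assume "poly (char_poly S) k = 0"
  define J where "J = Matrix.mat N N (\<lambda>(i,j). if i = j then 0 else 1 :: bit)"
  have J: "J \<in> carrier_mat N N" unfolding J_def by simp
  have oi: "of_int i = (of_bool (odd i) :: bit)" for i
  proof (cases "even i")
    case True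
    then obtain m where "i = 2 * m" by blast
    then show ?thesis by simp
  next
    case False
    then obtain m where "i = 2 * m + 1" by (rule oddE)
    then show ?thesis by simp
  qed
  have on: "of_nat m = (of_bool (odd m) :: bit)" for m
    using oi[of "int m"] by simp
  have "map_mat of_int S = J"
    using S odd unfolding J_def by (intro eq_matI) (auto simp: oi)
  then have cp: "char_poly J = map_poly of_int (char_poly S)"
    using of_int_hom.char_poly_hom[OF S, where ?'a=bit] by simp
  have cm: "char_matrix J 0 = J"
    unfolding char_matrix_def using J by (intro eq_matI) auto
  have "poly (char_poly J) (of_int k) = (of_int (poly (char_poly S) k) :: bit)"
    unfolding cp by simp
  also have "\<dots> = 0" using \<open>poly (char_poly S) k = 0\<close> by simp
  also have "of_int k = (0 :: bit)" using \<open>even k\<close> by (simp add: oi)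
  finally have "Determinant.det J = 0"
    using eigenvalue_root_char_poly[OF J, of 0] eigenvalue_det[OF J, of 0] cm by simp
  have "J * J = 1\<^sub>m N"
  proof (rule eq_matI)
    fix i j assume "i < dim_row (1\<^sub>m N)" "j < dim_col (1\<^sub>m N)"
    then have ij: "i < N" "j < N" by auto
    have "(J * J) $$ (i, j) = (\<Sum>l\<in>{..<N}. of_bool (i \<noteq> l \<and> l \<noteq> j))"
      using ij J by (simp add: scalar_prod_def lessThan_atLeast0 del: sum_of_bool_eq)
        (intro sum.cong, auto simp: J_def)
    also have "\<dots> = of_nat (card ({..<N} \<inter> {l. i \<noteq> l \<and> l \<noteq> j}))"
      by (simp only: sum_of_bool_eq finite_lessThan)
    also have "{..<N} \<inter> {l. i \<noteq> l \<and> l \<noteq> j} = {..<N} - {i, j}" by auto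
    also have "card \<dots> = N - (if i = j then 1 else 2)"
      using ij by (subst card_Diff_subset) auto
    also have "(of_nat \<dots> :: bit) = of_bool (odd \<dots>)"
      by (rule on)
    also have "\<dots> = 1\<^sub>m N $$ (i, j)"
      using ij \<open>even N\<close> by auto
    finally show "(J * J) $$ (i, j) = 1\<^sub>m N $$ (i, j)" .
  qed (use J in auto)
  then have "Determinant.det J * Determinant.det J = 1"
    using det_mult[OF J J] by simp
  then show False using \<open>Determinant.det J = 0\<close> by simp
qed

no_notation Matrix.scalar_prod (infix "\<bullet>" 70)
no_notation Matrix.vec_index (infixl "$" 100)

lemma root_if_power_dvd:
  fixes q :: "'a::idom poly"
  assumes "[:b, 1:] ^ m dvd q" "m > 0"
  shows "poly q (- b) = 0"
proof -
  have "[:b, 1:] dvd q"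
    using dvd_power[of m "[:b, 1:]"] assms dvd_trans by blast
  then show ?thesis by (simp add: poly_eq_0_iff_dvd)
qed

text \<open>The parameter is the inverse \<open>b\<close> of the cosine because \<open>- b\<close>
  is the Seidel eigenvalue whose integrality is at stake.\<close>

locale equiangular_lines =
  fixes X :: "(real ^ 'n) set" and b :: real
  assumes finite_X: "finite X" and b_gt_1: "b > 1"
    and norm_X: "x \<in> X \<Longrightarrow> x \<bullet> x = 1"
    and inner_X: "x \<in> X \<Longrightarrow> y \<in> X \<Longrightarrow> x \<noteq> y \<Longrightarrow> x \<bullet> y = 1 / b \<or> x \<bullet> y = - 1 / b"
begin

lemma subset: "Y \<subseteq> X \<Longrightarrow> equiangular_lines Y b"
  using finite_X b_gt_1 norm_X inner_X by unfold_locales (blast intro: finite_subset)+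

text \<open>\<open>S + b I\<close> is \<open>b\<close> times the Gram matrix, which factors through
  the ambient space as \<open>A * B\<close>.\<close>

lemma Seidel_matrix:
  obtains S :: "int Matrix.mat" where "S \<in> carrier_mat (card X) (card X)"
    and "\<And>i j. i < card X \<Longrightarrow> j < card X \<Longrightarrow> odd (S $$ (i,j)) \<longleftrightarrow> i \<noteq> j"
    and "CARD('n) \<le> card X \<Longrightarrow> [:b, 1:] ^ (card X - CARD('n)) dvd map_poly of_int (char_poly S)"
proof -
  let ?N = "card X" and ?n = "CARD('n)"
  obtain e where e: "bij_betw e {0..<?N} X"
    using ex_bij_betw_nat_finite[OF finite_X] by blast
  obtain f :: "nat \<Rightarrow> 'n" where f: "bij_betw f {0..<?n} UNIV"
    using ex_bij_betw_nat_finite[of "UNIV :: 'n set"] by auto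
  define S where "S = Matrix.mat ?N ?N (\<lambda>(i,j). if i = j then 0 else if e i \<bullet> e j > 0 then 1 else -1 :: int)"
  define A where "A = Matrix.mat ?N ?n (\<lambda>(i,k). b * e i $ f k)"
  define B where "B = Matrix.mat ?n ?N (\<lambda>(k,j). e j $ f k)"
  have eX: "e i \<in> X" if "i < ?N" for i
    using e that by (auto simp: bij_betw_def)
  have e_eq: "e i = e j \<longleftrightarrow> i = j" if "i < ?N" "j < ?N" for i j
    using e that by (auto simp: bij_betw_def inj_on_def)
  have S: "S \<in> carrier_mat ?N ?N" unfolding S_def by simp
  have "map_mat of_int S + b \<cdot>\<^sub>m 1\<^sub>m ?N = A * B"
  proof (rule eq_matI)
    fix i j assume "i < dim_row (A * B)" "j < dim_col (A * B)"
    then have ij: "i < ?N" "j < ?N" by (auto simp: A_def B_def)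
    have "(A * B) $$ (i, j) = (\<Sum>k\<in>{0..<?n}. b * (e i $ f k * e j $ f k))"
      using ij by (simp add: A_def B_def scalar_prod_def mult.assoc)
    also have "\<dots> = b * (e i \<bullet> e j)"
      unfolding inner_vec_def sum_distrib_left[symmetric]
      by (simp add: sum.reindex_bij_betw[OF f, of "\<lambda>k. e i $ k * e j $ k"])
    also have "\<dots> = (map_mat of_int S + b \<cdot>\<^sub>m 1\<^sub>m ?N) $$ (i, j)"
      using ij b_gt_1 norm_X[OF eX[of i]] inner_X[OF eX[of i] eX[of j]] e_eq[of i j]
      by (auto simp: S_def)
    finally show "(map_mat of_int S + b \<cdot>\<^sub>m 1\<^sub>m ?N) $$ (i, j) = (A * B) $$ (i, j)" ..
  qed (auto simp: A_def B_def)
  then have "[:b, 1:] ^ (?N - ?n) dvd char_poly (map_mat of_int S)" if "?n \<le> ?N"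
    by (intro char_poly_low_rank[of A ?N ?n B]) (auto simp: A_def B_def S that)
  then show thesis
    by (intro that[of S] S) (auto simp: of_int_hom.char_poly_hom[OF S], auto simp: S_def split: if_splits)
qed

text \<open>A root whose multiplicity exceeds half the degree is rational, and a rational algebraic
  integer is an integer.\<close>

lemma odd_inverse_angle:
  assumes "card X > 2 * CARD('n)"
  obtains k :: int where "b = of_int k" "odd k"
proof -
  obtain S where S: "S \<in> carrier_mat (card X) (card X)"
    and dvd: "[:b, 1:] ^ (card X - CARD('n)) dvd map_poly of_int (char_poly S)"
    by (rule Seidel_matrix) (use assms in auto)
  have monic: "lead_coeff (char_poly S) = 1" and deg: "Polynomial.degree (char_poly S) = card X"
    using degree_monic_char_poly[OF S] by auto
  define p where "p = map_poly (of_int :: int \<Rightarrow> rat) (char_poly S)"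
  have p: "p \<noteq> 0" "Polynomial.degree p = card X"
    using deg monic unfolding p_def by (auto simp: degree_map_poly)
  have pr: "map_poly of_rat p = map_poly (of_int :: int \<Rightarrow> real) (char_poly S)"
    unfolding p_def by (subst map_poly_map_poly) (auto simp: o_def)
  have nz: "map_poly (of_int :: int \<Rightarrow> real) (char_poly S) \<noteq> 0"
    using monic by auto
  have "card X - CARD('n) \<le> order (- b) (map_poly of_rat p)"
    using dvd nz order_divides[of "- b" _ "map_poly of_int (char_poly S)"] unfolding pr by simp
  then have "- b \<in> \<rat>"
    using order_le_degree_irrational[OF p(1), of "- b"] p(2) assms by linarith
  moreover have "poly (map_poly (of_int :: int \<Rightarrow> real) (char_poly S)) (- b) = 0"
    using dvd assms by (intro root_if_power_dvd) auto
  then have "algebraic_int (- b)"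
    unfolding algebraic_int_altdef_ipoly using monic by blast
  ultimately have "- b \<in> \<int>" by (rule rational_algebraic_int_is_int[rotated])
  then obtain k where k: "- b = of_int k" using Ints_cases by blast
  \<comment> \<open>The least even number above \<open>CARD('n)\<close>: a subset of this size still
    has the eigenvalue \<open>- b\<close>, and its even size allows the argument modulo 2.\<close>
  define m where "m = 2 * (CARD('n) div 2 + 1)"
  have m: "even m" "CARD('n) < m" by (auto simp: m_def)
  have "m \<le> card X"
    using assms zero_less_card_finite[where 'a='n] times_div_less_eq_dividend[of 2 "CARD('n)"]
    unfolding m_def distrib_left by linarith
  then obtain Y where Y: "Y \<subseteq> X" "card Y = m"
    by (meson obtain_subset_with_card_n)
  interpret Y: equiangular_lines Y b by (rule subset) fact
  obtain T where T: "T \<in> carrier_mat m m"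
    "\<And>i j. i < m \<Longrightarrow> j < m \<Longrightarrow> odd (T $$ (i,j)) \<longleftrightarrow> i \<noteq> j"
    and dvd': "[:b, 1:] ^ (m - CARD('n)) dvd map_poly of_int (char_poly T)"
    by (rule Y.Seidel_matrix) (use Y m in auto)
  have "poly (map_poly (of_int :: int \<Rightarrow> real) (char_poly T)) (of_int k) = 0"
    unfolding k[symmetric] using dvd' m by (intro root_if_power_dvd) auto
  then have "poly (char_poly T) k = 0" by simp
  then have "odd k" using Seidel_mod_2[OF T(1) m(1) _ T(2)] by blast
  then show thesis using k by (intro that[of "- k"]) auto
qed

end

section \<open>Tensors and harmonic polynomials\<close>

definition outer :: "real ^ 'n \<Rightarrow> real ^ 'n \<Rightarrow> real ^ 'n ^ 'n" where
  "outer x y = (\<chi> i j. x $ i * y $ j)"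

lemma inner_outer: "outer x y \<bullet> outer u v = (x \<bullet> u) * (y \<bullet> v)"
proof -
  have "outer x y \<bullet> outer u v = (\<Sum>i\<in>UNIV. \<Sum>j\<in>UNIV. (x $ i * u $ i) * (y $ j * v $ j))"
    by (simp add: outer_def inner_vec_def mult.assoc mult.left_commute)
  then show ?thesis by (simp add: inner_vec_def sum_product)
qed

lemma inner_outer_mat_1: "outer x y \<bullet> Finite_Cartesian_Product.mat 1 = x \<bullet> y"
proof -
  have "outer x y \<bullet> Finite_Cartesian_Product.mat 1 = (\<Sum>i\<in>UNIV. \<Sum>j\<in>UNIV. if j = i then x $ i * y $ j else 0)"
    unfolding outer_def inner_vec_def Finite_Cartesian_Product.mat_def
    by (auto intro!: sum.cong simp del: sum.delta sum.delta')
  then show ?thesis by (simp add: inner_vec_def)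
qed

lemma inner_mat_1_mat_1:
  "(Finite_Cartesian_Product.mat 1 :: real ^ 'n ^ 'n) \<bullet> Finite_Cartesian_Product.mat 1 = CARD('n)"
proof -
  have "(Finite_Cartesian_Product.mat 1 :: real ^ 'n ^ 'n) \<bullet> Finite_Cartesian_Product.mat 1
      = (\<Sum>i\<in>(UNIV :: 'n set). \<Sum>j\<in>(UNIV :: 'n set). if j = i then 1 else 0)"
    unfolding inner_vec_def Finite_Cartesian_Product.mat_def
    by (auto intro!: sum.cong simp del: sum.delta sum.delta')
  then show ?thesis by simp
qed

text \<open>This stands in for Cauchy-Schwarz on the eigenvalues, so that nothing has to be
  diagonalised.\<close>

lemma trace_square_le:
  fixes A :: "real ^ 'n ^ 'n"
  shows "(A \<bullet> Finite_Cartesian_Product.mat 1)\<^sup>2 \<le> CARD('n) * (A \<bullet> A)"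
  using Cauchy_Schwarz_ineq[of A "Finite_Cartesian_Product.mat 1"]
  by (simp add: inner_mat_1_mat_1 mult.commute)

definition outer3 :: "real ^ 'n \<Rightarrow> real ^ 'n \<Rightarrow> real ^ 'n \<Rightarrow> real ^ 'n ^ 'n ^ 'n" where
  "outer3 x y z = (\<chi> i j k. x $ i * y $ j * z $ k)"

lemma inner_outer3: "outer3 x y z \<bullet> outer3 u v w = (x \<bullet> u) * (y \<bullet> v) * (z \<bullet> w)"
proof -
  have "outer3 x y z \<bullet> outer3 u v w = (\<Sum>i\<in>UNIV. \<Sum>j\<in>UNIV. \<Sum>k\<in>UNIV. (x $ i * u $ i) * (y $ j * v $ j) * (z $ k * w $ k))"
    by (simp add: outer3_def inner_vec_def mult_ac)
  then show ?thesis
    by (simp only: inner_vec_def inner_real_def flip: sum_distrib_left sum_distrib_right)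
qed

text \<open>The traceless part of the third tensor power of a unit vector.\<close>

definition cubic_harmonic :: "real ^ 'n \<Rightarrow> real ^ 'n ^ 'n ^ 'n" where
  "cubic_harmonic y = outer3 y y y - (1 / (real CARD('n) + 2)) *\<^sub>R
     (\<Sum>a\<in>UNIV. outer3 (axis a 1) (axis a 1) y + outer3 (axis a 1) y (axis a 1) + outer3 y (axis a 1) (axis a 1))"

text \<open>The result is a multiple of the Gegenbauer polynomial of degree 3. With
  \<open>k = 1 / (n + 2)\<close> the correction terms \<open>- 6 k w\<close> and
  \<open>3 (n + 2) k\<^sup>2 w\<close> add up to \<open>- 3 k w\<close>.\<close>

lemma inner_cubic_harmonic:
  fixes y z :: "real ^ 'n"
  assumes "y \<bullet> y = 1" "z \<bullet> z = 1"
  shows "cubic_harmonic y \<bullet> cubic_harmonic z = (y \<bullet> z) ^ 3 - 3 / (real CARD('n) + 2) * (y \<bullet> z)"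
proof -
  define n where "n = real CARD('n)"
  let ?D = "\<lambda>y::real ^ 'n. \<Sum>a\<in>UNIV. outer3 (axis a 1) (axis a 1) y + outer3 (axis a 1) y (axis a 1) + outer3 y (axis a 1) (axis a 1)"
  let ?w = "y \<bullet> z"
  have ax: "axis a (1::real) \<bullet> axis a' 1 = (if a = a' then 1 else 0)" for a a' :: 'n
    by (simp add: inner_axis_axis)
  have contract: "(\<Sum>a\<in>UNIV. u $ a * v $ a) = u \<bullet> v" "(\<Sum>a\<in>UNIV. u $ a * v $ a * c) = (u \<bullet> v) * c"
    "(\<Sum>a\<in>UNIV. u $ a * c * v $ a) = (u \<bullet> v) * c"
    "(\<Sum>a\<in>UNIV. c * u $ a * v $ a) = (u \<bullet> v) * c" for u v :: "real ^ 'n" and c :: real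
    by (simp_all add: inner_vec_def sum_distrib_left mult_ac)
  have axis_nth_if: "axis a (1::real) $ i = (if a = i then 1 else 0)" for a i :: 'n
    by (simp add: axis_def)
  have 1: "outer3 y y y \<bullet> ?D z = 3 * ?w"
    using assms by (simp add: inner_sum_right inner_add_right inner_outer3 inner_axis sum.distrib contract)
  have 2: "?D y \<bullet> outer3 z z z = 3 * ?w"
    using assms by (simp add: inner_sum_left inner_add_left inner_outer3 inner_axis' sum.distrib contract)
  have 3: "?D y \<bullet> ?D z = 3 * n * ?w + 6 * ?w"
    by (simp add: inner_sum_left inner_sum_right inner_add_left inner_add_right inner_outer3 ax inner_axis inner_axis'
        sum.distrib contract n_def axis_nth_if mult_delta_left mult_delta_right inner_commute[of z y])
      (simp add: inner_vec_def sum_distrib_left)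
  define k where "k = 1 / (n + 2)"
  have "cubic_harmonic y \<bullet> cubic_harmonic z = ?w ^ 3 - k * (6 * ?w) + k\<^sup>2 * (3 * n * ?w + 6 * ?w)"
    unfolding cubic_harmonic_def n_def[symmetric] k_def[symmetric]
    by (simp add: inner_diff_left inner_diff_right 1 2 3 inner_outer3)
      (simp add: algebra_simps power2_eq_square power3_eq_cube)
  also have "k\<^sup>2 * (3 * n * ?w + 6 * ?w) = 3 / (n + 2) * ?w"
    unfolding k_def n_def by (simp add: divide_simps power2_eq_square) (simp add: algebra_simps)
  finally show ?thesis unfolding n_def k_def by simp
qed

text \<open>The double sum is the squared norm of the sum of the tensors
  \<open>cubic_harmonic (v i)\<close>.\<close>

lemma sum_cubic_harmonic_nonneg:
  fixes v :: "'i \<Rightarrow> real ^ 'n"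
  assumes "\<And>i. i \<in> I \<Longrightarrow> v i \<bullet> v i = 1"
  shows "0 \<le> (\<Sum>i\<in>I. \<Sum>j\<in>I. (v i \<bullet> v j) ^ 3 - 3 / (real CARD('n) + 2) * (v i \<bullet> v j))"
proof -
  have "0 \<le> (\<Sum>i\<in>I. cubic_harmonic (v i)) \<bullet> (\<Sum>i\<in>I. cubic_harmonic (v i))" by simp
  also have "\<dots> = (\<Sum>i\<in>I. \<Sum>j\<in>I. cubic_harmonic (v i) \<bullet> cubic_harmonic (v j))"
    by (simp only: inner_sum_left, simp only: inner_sum_right)
  finally show ?thesis by (simp add: inner_cubic_harmonic assms cong: sum.cong)
qed

section \<open>Bounds on the size\<close>

context equiangular_lines
begin

lemma inner_power2: "x \<in> X \<Longrightarrow> y \<in> X \<Longrightarrow> x \<noteq> y \<Longrightarrow> (x \<bullet> y)\<^sup>2 = 1 / b\<^sup>2"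
  using inner_X[of x y] by (auto simp: power_divide)

text \<open>The squared norm of a row of the Gram matrix, the same for every row.\<close>

definition rowsum :: real where "rowsum = 1 + (card X - 1) / b\<^sup>2"

lemma sum_inner_power2:
  assumes "x \<in> X"
  shows "(\<Sum>y\<in>X. (x \<bullet> y)\<^sup>2) = rowsum"
proof -
  have "(\<Sum>y\<in>X. (x \<bullet> y)\<^sup>2) = (x \<bullet> x)\<^sup>2 + (\<Sum>y\<in>X-{x}. (x \<bullet> y)\<^sup>2)"
    by (rule sum.remove[OF finite_X assms])
  also have "(\<Sum>y\<in>X-{x}. (x \<bullet> y)\<^sup>2) = (\<Sum>y\<in>X-{x}. 1 / b\<^sup>2)"
    by (intro sum.cong) (use assms inner_power2 in auto)
  also have "\<dots> = (card X - 1) / b\<^sup>2"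
    using finite_X assms by simp
  finally show ?thesis unfolding rowsum_def using norm_X[OF assms] by simp
qed

text \<open>Its nonzero spectrum is that of the Gram matrix, so its trace and Hilbert-Schmidt norm
  depend only on \<open>card X\<close> and \<open>b\<close>.\<close>

definition frame :: "real ^ 'n ^ 'n" where "frame = (\<Sum>x\<in>X. outer x x)"

lemma inner_frame_mat_1: "frame \<bullet> Finite_Cartesian_Product.mat 1 = card X"
  by (simp add: frame_def inner_sum_left inner_outer_mat_1 norm_X)

lemma inner_frame_outer: "frame \<bullet> outer u v = (\<Sum>x\<in>X. (x \<bullet> u) * (x \<bullet> v))"
  by (simp add: frame_def inner_sum_left inner_outer)

lemma inner_frame_frame: "frame \<bullet> frame = card X * rowsum"
proof -
  have "frame \<bullet> frame = (\<Sum>x\<in>X. \<Sum>y\<in>X. (x \<bullet> y)\<^sup>2)"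
    unfolding frame_def by (simp only: inner_sum_left, simp only: inner_sum_right)
      (simp add: inner_outer power2_eq_square)
  then show ?thesis by (simp add: sum_inner_power2)
qed

text \<open>This is \<open>trace_square_le\<close> for \<open>frame\<close>, cleared of denominators
  so that no sign of \<open>b\<^sup>2 - CARD('n)\<close> has to be assumed.\<close>

lemma relative_bound: "real (card X) * (b\<^sup>2 - CARD('n)) \<le> CARD('n) * (b\<^sup>2 - 1)"
proof (cases "X = {}")
  case True
  have "1 \<le> b\<^sup>2" using b_gt_1 by simp
  with True show ?thesis by simp
next
  case False
  then have N: "card X \<ge> 1" using finite_X by (simp add: Suc_le_eq card_gt_0_iff)
  have "real (card X) * card X \<le> card X * (CARD('n) * rowsum)"
    using trace_square_le[of frame]
    unfolding inner_frame_mat_1 inner_frame_frame by (simp add: power2_eq_square mult_ac)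
  then have "real (card X) \<le> CARD('n) * rowsum"
    using N by simp
  then have "real (card X) * b\<^sup>2 \<le> (CARD('n) * rowsum) * b\<^sup>2"
    by (rule mult_right_mono) simp
  also have "\<dots> = CARD('n) * (b\<^sup>2 + (card X - 1))"
    using b_gt_1 unfolding rowsum_def by (simp add: field_simps)
  finally show ?thesis using N by (simp add: algebra_simps of_nat_diff)
qed

section \<open>Small \<open>b\<close>: the dominant eigenvalue of the frame operator\<close>

text \<open>\<open>Z\<close> is \<open>frame\<close> minus its orthogonal projection to the line of
  \<open>outer e e\<close>. Its trace and norm are therefore explicit even if \<open>e\<close> is
  not an eigenvector.\<close>

lemma deviation_bound:
  fixes e :: "real ^ 'n" and \<mu> :: real
  assumes "e \<noteq> 0"
  defines "\<mu> \<equiv> (\<Sum>x\<in>X. (x \<bullet> e)\<^sup>2) / (e \<bullet> e)"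
  shows "(card X - \<mu>)\<^sup>2 \<le> CARD('n) * (card X * rowsum - \<mu>\<^sup>2)"
proof -
  define Z where "Z = frame - (\<mu> / (e \<bullet> e)) *\<^sub>R outer e e"
  have e: "e \<bullet> e \<noteq> 0" using assms by simp
  have fe: "frame \<bullet> outer e e = \<mu> * (e \<bullet> e)"
    using e by (simp add: inner_frame_outer \<mu>_def power2_eq_square)
  have "Z \<bullet> Finite_Cartesian_Product.mat 1 = card X - \<mu>"
    using e by (simp add: Z_def inner_diff_left inner_frame_mat_1 inner_outer_mat_1)
  moreover have "Z \<bullet> Z = card X * rowsum - \<mu>\<^sup>2"
    using e fe unfolding Z_def
    by (simp add: inner_diff_left inner_diff_right inner_frame_frame inner_commute[of "outer e e" frame] inner_outer power2_eq_square)
  ultimately show ?thesis using trace_square_le[of Z] by simp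
qed

text \<open>Bessel's inequality for the symmetrised \<open>outer x y\<close> bounds the sum
  \<open>Q\<close> of squared deviations of the \<open>v z\<close> from their mean by 1/2. Each
  \<open>(v z)\<^sup>2\<close> is at least \<open>1 / b ^ 4\<close>, so the mean itself must be
  large.\<close>

lemma inner_frame_vector_lower:
  assumes "x \<in> X" "y \<in> X" "x \<noteq> y"
  shows "card X * (card X / b ^ 4 - 1 / 2) \<le> (\<Sum>z\<in>X. (x \<bullet> z) * (y \<bullet> z))\<^sup>2"
proof -
  define N where "N = real (card X)"
  \<comment> \<open>\<open>C\<close> is the projection of \<open>Y\<close> to the matrices \<open>\<Sum>c z *\<^sub>R outer z z\<close> with \<open>\<Sum>c z = 0\<close>.\<close>
  define v where "v z = (x \<bullet> z) * (y \<bullet> z)" for z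
  define V where "V = (\<Sum>z\<in>X. v z)"
  define A where "A = 1 / b\<^sup>2"
  define c where "c z = (v z - V / N) / (1 - A)" for z
  define Y where "Y = (1/2) *\<^sub>R (outer x y + outer y x)"
  define C where "C = (\<Sum>z\<in>X. c z *\<^sub>R outer z z)"
  define Q where "Q = (\<Sum>z\<in>X. (v z)\<^sup>2) - V\<^sup>2 / N"
  have N: "N > 0" using assms finite_X by (auto simp: N_def card_gt_0_iff)
  have A: "0 < A" "A < 1" using b_gt_1 by (auto simp: A_def)
  have sum_c: "(\<Sum>z\<in>X. c z) = 0"
    using N by (simp add: c_def sum_subtractf V_def[symmetric] N_def flip: sum_divide_distrib)
  have sum_cv: "(\<Sum>z\<in>X. c z * v z) = Q / (1 - A)"
  proof -
    have "(\<Sum>z\<in>X. c z * v z) = (\<Sum>z\<in>X. (v z)\<^sup>2 - V / N * v z) / (1 - A)"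
      by (simp add: c_def sum_divide_distrib algebra_simps power2_eq_square)
    also have "(\<Sum>z\<in>X. (v z)\<^sup>2 - V / N * v z) = Q"
      unfolding sum_subtractf sum_distrib_left[symmetric] V_def[symmetric] Q_def
      by (simp add: power2_eq_square)
    finally show ?thesis .
  qed
  have sum_cc: "(\<Sum>z\<in>X. c z * c z) = Q / (1 - A)\<^sup>2"
  proof -
    have "(\<Sum>z\<in>X. c z * c z) = (\<Sum>z\<in>X. c z * v z / (1 - A) - V / N / (1 - A) * c z)"
    proof (rule sum.cong[OF refl])
      fix z
      have "c z = v z / (1 - A) - V / N / (1 - A)" by (simp add: c_def diff_divide_distrib)
      then have "c z * c z = c z * (v z / (1 - A) - V / N / (1 - A))" by simp
      then show "c z * c z = c z * v z / (1 - A) - V / N / (1 - A) * c z"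
        by (simp add: right_diff_distrib mult.commute)
    qed
    also have "\<dots> = Q / (1 - A) / (1 - A)"
      unfolding sum_subtractf sum_distrib_left[symmetric] sum_divide_distrib[symmetric] sum_cv sum_c
      by simp
    finally show ?thesis by (simp add: power2_eq_square)
  qed
  have "outer z z \<bullet> Y = v z" for z
    by (simp add: Y_def inner_add_right inner_outer v_def inner_commute[of z])
  then have "C \<bullet> Y = (\<Sum>z\<in>X. c z * v z)"
    by (simp add: C_def inner_sum_left)
  then have CY: "C \<bullet> Y = Q / (1 - A)" using sum_cv by simp
  have "(x \<bullet> y) * (x \<bullet> y) = A"
    using inner_power2[of x y] assms by (simp add: A_def power2_eq_square)
  then have YY: "Y \<bullet> Y = (1 + A) / 2"
    using norm_X assms
    by (simp add: Y_def inner_add_right inner_add_left inner_outer inner_commute[of y x]) (simp add: field_simps)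
  have "C \<bullet> C = (\<Sum>z\<in>X. \<Sum>u\<in>X. c z * c u * (z \<bullet> u)\<^sup>2)"
    unfolding C_def by (simp only: inner_sum_left, simp only: inner_sum_right)
      (simp add: inner_outer power2_eq_square mult_ac)
  \<comment> \<open>The matrices \<open>outer z z\<close> have norm 1 and mutual inner products
    \<open>A\<close>, so on coefficients with sum zero their Gram matrix acts as
    \<open>1 - A\<close>.\<close>
  also have "\<dots> = (\<Sum>z\<in>X. \<Sum>u\<in>X. c z * c u * A + (if z = u then c z * c u * (1 - A) else 0))"
    by (intro sum.cong refl) (auto simp: norm_X inner_power2 A_def algebra_simps)
  also have "\<dots> = A * ((\<Sum>z\<in>X. c z) * (\<Sum>u\<in>X. c u)) + (1 - A) * (\<Sum>z\<in>X. c z * c z)"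
    using finite_X by (simp add: sum.distrib sum_product sum_distrib_left mult_ac)
  finally have CC: "C \<bullet> C = Q / (1 - A)"
    using A by (simp add: sum_c sum_cc power2_eq_square)
  have "0 \<le> (Y - C) \<bullet> (Y - C)" by simp
  also have "\<dots> = (1 + A) / 2 - Q / (1 - A)"
    by (simp add: inner_diff_left inner_diff_right YY CC CY inner_commute[of Y C])
  finally have "Q \<le> (1 - A) * (1 + A) / 2"
    using A by (simp add: field_simps)
  also have "\<dots> \<le> 1 / 2" using A by (simp add: algebra_simps)
  finally have "Q \<le> 1 / 2" .
  moreover have "N * A\<^sup>2 \<le> (\<Sum>z\<in>X. (v z)\<^sup>2)"
  proof -
    have "A\<^sup>2 \<le> (v z)\<^sup>2" if "z \<in> X" for z
    proof -
      have "A \<le> (x \<bullet> z)\<^sup>2" if "x \<in> X" for x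
        using inner_power2[OF that \<open>z \<in> X\<close>] norm_X[OF that] A by (cases "x = z") (auto simp: A_def)
      then have "A * A \<le> (x \<bullet> z)\<^sup>2 * (y \<bullet> z)\<^sup>2"
        using assms A by (intro mult_mono) auto
      then show ?thesis by (simp add: v_def power2_eq_square mult_ac)
    qed
    then have "(\<Sum>z\<in>X. A\<^sup>2) \<le> (\<Sum>z\<in>X. (v z)\<^sup>2)" by (rule sum_mono)
    then show ?thesis by (simp add: N_def)
  qed
  ultimately have "N * A\<^sup>2 - 1 / 2 \<le> V\<^sup>2 / N" unfolding Q_def by simp
  then have "N * (N * A\<^sup>2 - 1 / 2) \<le> V\<^sup>2"
    using N by (simp add: field_simps)
  then show ?thesis by (simp add: N_def V_def v_def A_def power_divide flip: power_mult)
qed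

text \<open>\<open>\<mu>\<close> is the Rayleigh quotient of the frame operator at the image \<open>e\<close> of a point \<open>y\<close> of \<open>X\<close>, a proxy
  for the largest eigenvalue that avoids the spectral theorem.\<close>

lemma dominant_eigenvalue:
  assumes "X \<noteq> {}"
  defines "N \<equiv> real (card X)"
  obtains \<mu> :: real where "0 \<le> \<mu>" "(N - \<mu>)\<^sup>2 \<le> CARD('n) * (N * rowsum - \<mu>\<^sup>2)"
    and "rowsum\<^sup>2 + (N - 1) * (N * (N / b ^ 4 - 1 / 2)) \<le> \<mu>\<^sup>2 * rowsum"
proof -
  obtain y where y: "y \<in> X" using assms by blast
  have N: "N \<ge> 1" using finite_X y by (auto simp: N_def Suc_le_eq card_gt_0_iff)
  have rho: "rowsum > 0"
    using N unfolding rowsum_def by (intro add_pos_nonneg) auto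
  define e where "e = (\<Sum>z\<in>X. (y \<bullet> z) *\<^sub>R z)"
  define E where "E = (\<Sum>x\<in>X. (x \<bullet> e)\<^sup>2)"
  have xe: "x \<bullet> e = (\<Sum>z\<in>X. (x \<bullet> z) * (y \<bullet> z))" for x
    by (simp add: e_def inner_sum_right mult.commute)
  have ye: "y \<bullet> e = rowsum"
    unfolding xe sum_inner_power2[OF y, symmetric] by (simp add: power2_eq_square)
  then have e: "e \<noteq> 0" using rho by auto
  have ee: "e \<bullet> e = (\<Sum>z\<in>X. (y \<bullet> z) * (z \<bullet> e))"
    by (subst (1) e_def) (simp add: inner_sum_left)
  have "(e \<bullet> e)\<^sup>2 \<le> rowsum * E"
    unfolding ee E_def sum_inner_power2[OF y, symmetric] by (rule Cauchy_Schwarz_ineq_sum)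
  define \<mu> where "\<mu> = E / (e \<bullet> e)"
  have "E \<ge> 0" unfolding E_def by (simp add: sum_nonneg)
  \<comment> \<open>\<open>x \<bullet> e\<close> is an entry of the squared Gram matrix:
    \<open>rowsum\<close> at \<open>x = y\<close>, and bounded below in absolute value elsewhere by
    \<open>inner_frame_vector_lower\<close>.\<close>
  have "rowsum\<^sup>2 + (N - 1) * (N * (N / b ^ 4 - 1 / 2)) \<le> E"
  proof -
    have "(\<Sum>x\<in>X-{y}. N * (N / b ^ 4 - 1 / 2)) \<le> (\<Sum>x\<in>X-{y}. (x \<bullet> e)\<^sup>2)"
      unfolding N_def xe by (intro sum_mono inner_frame_vector_lower) (use y in auto)
    moreover have "E = (y \<bullet> e)\<^sup>2 + (\<Sum>x\<in>X-{y}. (x \<bullet> e)\<^sup>2)"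
      unfolding E_def by (rule sum.remove[OF finite_X y])
    moreover have "real (card X - 1) = N - 1" using N by (simp add: N_def)
    ultimately show ?thesis using y finite_X by (simp add: ye)
  qed
  also have "E \<le> \<mu>\<^sup>2 * rowsum"
  proof (cases "E = 0")
    case False
    then have "E > 0" using \<open>E \<ge> 0\<close> by simp
    have "E * (e \<bullet> e)\<^sup>2 \<le> E * (rowsum * E)"
      using \<open>(e \<bullet> e)\<^sup>2 \<le> rowsum * E\<close> \<open>E \<ge> 0\<close> by (rule mult_left_mono)
    then show ?thesis
      using e unfolding \<mu>_def by (simp add: field_simps power2_eq_square)
  qed (use rho in simp)
  finally have 1: "rowsum\<^sup>2 + (N - 1) * (N * (N / b ^ 4 - 1 / 2)) \<le> \<mu>\<^sup>2 * rowsum" .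
  have 2: "(N - \<mu>)\<^sup>2 \<le> CARD('n) * (N * rowsum - \<mu>\<^sup>2)"
    using deviation_bound[OF e] unfolding \<mu>_def E_def N_def .
  have "0 \<le> \<mu>" unfolding \<mu>_def using \<open>E \<ge> 0\<close> by simp
  then show thesis using 1 2 that by blast
qed

text \<open>\<open>t\<close> is a bound for \<open>\<mu> / N\<close>, obtained from
  \<open>\<mu>\<^sup>2 \<le> N * rowsum\<close>. Besides the dominant eigenvalue there remain a
  trace of at least \<open>(1 - t) * N\<close> and a squared norm of at most \<open>N * K\<close>;
  \<open>deviation_bound\<close> compares the two.\<close>

lemma small_angle_bound:
  assumes "N = real (card X)" "N \<ge> 1" "0 \<le> t" "t \<le> 1" "N / b\<^sup>2 + 1 \<le> t\<^sup>2 * N"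
  shows "(1 - t)\<^sup>2 * N \<le> CARD('n) * (b\<^sup>2 / 2 + 2 + b\<^sup>2 / N)"
proof -
  define A where "A = 1 / b\<^sup>2"
  define K where "K = b\<^sup>2 / 2 + 2 + b\<^sup>2 / N"
  have A: "0 < A" "A < 1" using b_gt_1 by (auto simp: A_def)
  have "X \<noteq> {}" using assms by auto
  then obtain \<mu> :: real where \<mu>: "0 \<le> \<mu>" "(N - \<mu>)\<^sup>2 \<le> CARD('n) * (N * rowsum - \<mu>\<^sup>2)"
    "rowsum\<^sup>2 + (N - 1) * (N * (N / b ^ 4 - 1 / 2)) \<le> \<mu>\<^sup>2 * rowsum"
    using dominant_eigenvalue unfolding assms(1) by blast
  have "real (card X - 1) = N - 1" using assms by simp
  then have rho: "rowsum = N * A + (1 - A)"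
    unfolding rowsum_def A_def by (simp add: diff_divide_distrib)
  have b4: "N / b ^ 4 = N * A\<^sup>2" by (simp add: A_def power_divide flip: power_mult)
  have "rowsum > 0" using A assms unfolding rho by (intro add_pos_pos) auto
  have "rowsum\<^sup>2 - N * (N * A\<^sup>2 - 1 / 2) \<le> N / 2 + 2 * N * A + 1"
  proof -
    have "rowsum\<^sup>2 - N * (N * A\<^sup>2 - 1 / 2) = N / 2 + 2 * N * A * (1 - A) + (1 - A)\<^sup>2"
      unfolding rho by (simp add: algebra_simps power2_eq_square)
    moreover have "2 * N * A * (1 - A) \<le> 2 * N * A * 1"
      using A assms by (intro mult_left_mono) auto
    moreover have "(1 - A)\<^sup>2 \<le> 1\<^sup>2" using A by (intro power_mono) auto
    ultimately show ?thesis by simp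
  qed
  \<comment> \<open>The terms quadratic in \<open>N\<close> have cancelled; \<open>K\<close> is what
    remains, divided by \<open>N * A\<close>, the main term of \<open>rowsum\<close>.\<close>
  also have "\<dots> = N * A * K"
    using b_gt_1 assms(2) unfolding A_def K_def by (simp add: field_simps)
  also have "\<dots> \<le> rowsum * K"
    using A assms unfolding rho K_def by (intro mult_right_mono) auto
  finally have "(N - 1) * (rowsum\<^sup>2 - N * (N * A\<^sup>2 - 1 / 2)) \<le> (N - 1) * (rowsum * K)"
    using assms by (intro mult_left_mono) auto
  with \<mu>(3) have "rowsum * (N * rowsum - \<mu>\<^sup>2) \<le> rowsum * ((N - 1) * K)"
    unfolding b4 by (simp add: algebra_simps power2_eq_square)
  then have "N * rowsum - \<mu>\<^sup>2 \<le> (N - 1) * K"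
    using \<open>rowsum > 0\<close> by simp
  also have "\<dots> \<le> N * K" using assms by (intro mult_right_mono) (auto simp: K_def)
  finally have NK: "N * rowsum - \<mu>\<^sup>2 \<le> N * K" .
  have "\<mu>\<^sup>2 \<le> N * rowsum"
  proof -
    have "0 \<le> CARD('n) * (N * rowsum - \<mu>\<^sup>2)" using \<mu>(2) by (smt (verit) zero_le_power2)
    then show ?thesis by (simp add: zero_le_mult_iff)
  qed
  also have "\<dots> \<le> N * (N / b\<^sup>2 + 1)"
    using A assms unfolding rho A_def by (intro mult_left_mono) auto
  also have "\<dots> \<le> N * (t\<^sup>2 * N)" using assms by (intro mult_left_mono) auto
  finally have "\<mu>\<^sup>2 \<le> (t * N)\<^sup>2" by (simp add: power2_eq_square mult_ac)
  then have "\<mu> \<le> t * N" using assms by (simp add: power2_le_iff_abs_le)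
  then have "((1 - t) * N)\<^sup>2 \<le> (N - \<mu>)\<^sup>2"
    using assms by (intro power_mono) (auto simp: algebra_simps)
  also have "\<dots> \<le> CARD('n) * (N * K)"
    using \<mu>(2) NK by (meson mult_left_mono of_nat_0_le_iff order_trans)
  finally have "N * ((1 - t)\<^sup>2 * N) \<le> N * (CARD('n) * K)"
    by (simp add: power2_eq_square mult_ac)
  then show ?thesis using assms(2) unfolding K_def by simp
qed

end

section \<open>Parseval's identity and the dimension spanned by a tight frame\<close>

lemma in_span_orthonormal:
  fixes B :: "'a::real_inner set"
  assumes "finite B" "pairwise Linear_Algebra.orthogonal B" "\<And>e. e \<in> B \<Longrightarrow> e \<bullet> e = 1" "x \<in> span B"
  shows "x \<bullet> x = (\<Sum>e\<in>B. (x \<bullet> e)\<^sup>2)"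
proof -
  define y where "y = x - (\<Sum>e\<in>B. (x \<bullet> e) *\<^sub>R e)"
  have "y \<in> span B" unfolding y_def using assms(4) by (intro span_diff span_sum span_scale) (auto intro: span_base)
  have ye: "Linear_Algebra.orthogonal y e" if "e \<in> B" for e
  proof -
    have "(\<Sum>f\<in>B. (x \<bullet> f) * (f \<bullet> e)) = (\<Sum>f\<in>B. if f = e then x \<bullet> e else 0)"
      using assms(2,3) that by (intro sum.cong) (auto simp: pairwise_def Linear_Algebra.orthogonal_def)
    then show ?thesis
      using assms(1) that by (simp add: y_def Linear_Algebra.orthogonal_def inner_diff_left inner_sum_left)
  qed
  have "Linear_Algebra.orthogonal y y"
    by (rule orthogonal_to_span[OF \<open>y \<in> span B\<close>]) (use ye in \<open>auto simp: orthogonal_commute\<close>)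
  then have "x = (\<Sum>e\<in>B. (x \<bullet> e) *\<^sub>R e)" by (simp add: y_def Linear_Algebra.orthogonal_def)
  then have "x \<bullet> x = x \<bullet> (\<Sum>e\<in>B. (x \<bullet> e) *\<^sub>R e)" by simp
  also have "\<dots> = (\<Sum>e\<in>B. (x \<bullet> e)\<^sup>2)"
    by (simp add: inner_sum_right power2_eq_square)
  finally show ?thesis .
qed

text \<open>Two evaluations of the trace of the frame operator on the span: it acts there as the
  scalar \<open>c\<close>, and by Parseval its trace is the sum of the squared norms of the
  points.\<close>

lemma dim_span_tight_frame:
  fixes X :: "'a::euclidean_space set"
  assumes "finite X" "\<And>x. x \<in> X \<Longrightarrow> x \<bullet> x = 1"
    and eig: "\<And>x. x \<in> X \<Longrightarrow> (\<Sum>y\<in>X. (x \<bullet> y) *\<^sub>R y) = c *\<^sub>R x"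
  shows "c * dim X = card X"
proof -
  obtain B where B: "B \<subseteq> span X" "pairwise Linear_Algebra.orthogonal B" "\<And>e. e \<in> B \<Longrightarrow> norm e = 1"
    "independent B" "card B = dim (span X)" "span B = span X"
    using orthonormal_basis_subspace[of "span X"] by auto
  have fin: "finite B" using B(4) by (rule independent_imp_finite)
  have unit: "e \<bullet> e = 1" if "e \<in> B" for e using B(3)[OF that] by (simp add: norm_eq_1)
  let ?F = "\<lambda>v. \<Sum>y\<in>X. (v \<bullet> y) *\<^sub>R y"
  have F: "?F v = c *\<^sub>R v" if "v \<in> span X" for v
  proof (rule linear_eq_on_span[OF _ _ _ that])
    show "linear ?F" by (intro linearI) (simp_all add: inner_add_left scaleR_add_left sum.distrib scaleR_right.sum)
    show "linear (\<lambda>v. c *\<^sub>R v)" by (rule linear_scaleR)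
  qed (rule eig)
  have "c * dim X = (\<Sum>e\<in>B. e \<bullet> (c *\<^sub>R e))"
    using unit B(5) by simp
  also have "\<dots> = (\<Sum>e\<in>B. e \<bullet> ?F e)"
    using B(1) F by (intro sum.cong) auto
  also have "\<dots> = (\<Sum>e\<in>B. \<Sum>y\<in>X. (y \<bullet> e)\<^sup>2)"
    by (simp add: inner_sum_right power2_eq_square inner_commute)
  also have "\<dots> = (\<Sum>y\<in>X. \<Sum>e\<in>B. (y \<bullet> e)\<^sup>2)" by (rule sum.swap)
  also have "\<dots> = (\<Sum>y\<in>X. y \<bullet> y)"
    by (intro sum.cong refl in_span_orthonormal[symmetric] fin B(2) unit) (simp_all add: B(6) span_base)
  also have "\<dots> = card X" using assms(2) by simp
  finally show ?thesis .
qed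

section \<open>The cubic bound by projection from a point, and its equality case\<close>

context equiangular_lines
begin

text \<open>The vectors \<open>v y\<close> below are the points of \<open>X\<close> other than \<open>x\<close>, signed so as to lie in the
  half-space of \<open>x\<close>, projected to the orthogonal complement of \<open>x\<close> and normalised. Their inner products
  take only the values \<open>1 / (b + 1)\<close> and \<open>- 1 / (b - 1)\<close>, and the cubic
  \<open>(b\<^sup>2 - 1)\<^sup>2 / 2 * w ^ 3 - (b\<^sup>2 + 3) / 2 * w\<close> equals \<open>- 1\<close> at both.\<close>

lemma derived_set_bound:
  assumes x: "x \<in> X"
  defines "v \<equiv> \<lambda>y. (1 / sqrt (1 - 1 / b\<^sup>2)) *\<^sub>R ((b * (x \<bullet> y)) *\<^sub>R y - (1 / b) *\<^sub>R x)"
  defines "s \<equiv> \<Sum>y\<in>X-{x}. v y"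
  shows "((b\<^sup>2 - 1)\<^sup>2 / 2 * (3 / (real CARD('n) + 2)) - (b\<^sup>2 + 3) / 2) * (s \<bullet> s)
     \<le> (card X - 1) * ((b\<^sup>2 - 1) * (b\<^sup>2 - 2) / 2 - card X)"
proof -
  let ?M = "real (card X - 1)" and ?I = "X - {x}"
  define P where "P = (b\<^sup>2 - 1)\<^sup>2 / 2"
  define Q where "Q = (b\<^sup>2 + 3) / 2"
  define k where "k = 3 / (real CARD('n) + 2)"
  define f where "f w = P * w ^ 3 - Q * w" for w :: real
  have b: "b > 1" "b\<^sup>2 > 1" "b\<^sup>2 \<noteq> 1" using b_gt_1 by (auto simp: power2_eq_1_iff)
  have vv: "v y \<bullet> v z = (b\<^sup>2 * ((x \<bullet> y) * (x \<bullet> z) * (y \<bullet> z)) - 1 / b\<^sup>2) / (1 - 1 / b\<^sup>2)"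
    if yz: "y \<in> ?I" "z \<in> ?I" for y z
  proof -
    define r where "r = sqrt (1 - 1 / b\<^sup>2)"
    have r: "r * r = 1 - 1 / b\<^sup>2" unfolding r_def using b by (subst real_sqrt_mult_self) auto
    have xy: "(x \<bullet> y) * (x \<bullet> y) = 1 / b\<^sup>2" "(x \<bullet> z) * (x \<bullet> z) = 1 / b\<^sup>2"
      using inner_power2[of x y] inner_power2[of x z] yz x by (auto simp: power2_eq_square)
    have "v y \<bullet> v z = (b * b * ((x \<bullet> y) * (x \<bullet> z) * (y \<bullet> z)) - (x \<bullet> y) * (x \<bullet> y) - (x \<bullet> z) * (x \<bullet> z) + 1 / b\<^sup>2) / (r * r)"
      using b norm_X[OF x] unfolding v_def r_def[symmetric]
      by (simp add: inner_diff_left inner_diff_right inner_commute[of y x] power2_eq_square divide_simps)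
        (simp add: algebra_simps)
    then show ?thesis unfolding xy r by (simp add: power2_eq_square)
  qed
  have unit: "v y \<bullet> v y = 1" if "y \<in> ?I" for y
  proof -
    have "(x \<bullet> y) * (x \<bullet> y) = 1 / b\<^sup>2" "y \<bullet> y = 1"
      using that x inner_power2[of x y] norm_X[of y] by (auto simp: power2_eq_square)
    then show ?thesis unfolding vv[OF that that] using b by simp
  qed
  have inner_values: "v y \<bullet> v z = 1 / (b + 1) \<or> v y \<bullet> v z = - 1 / (b - 1)" if yz: "y \<in> ?I" "z \<in> ?I" "y \<noteq> z" for y z
  proof -
    have "x \<bullet> y = 1 / b \<or> x \<bullet> y = - 1 / b" "x \<bullet> z = 1 / b \<or> x \<bullet> z = - 1 / b"
      "y \<bullet> z = 1 / b \<or> y \<bullet> z = - 1 / b"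
      using inner_X x yz by auto
    then have product: "b\<^sup>2 * ((x \<bullet> y) * (x \<bullet> z) * (y \<bullet> z)) = 1 / b \<or> b\<^sup>2 * ((x \<bullet> y) * (x \<bullet> z) * (y \<bullet> z)) = - 1 / b"
      using b by (auto simp: power2_eq_square)
    have plus: "(1 / b - 1 / b\<^sup>2) / (1 - 1 / b\<^sup>2) = 1 / (b + 1)"
      using b by (simp add: divide_simps power2_eq_square) (simp add: algebra_simps)
    have minus: "(- 1 / b - 1 / b\<^sup>2) / (1 - 1 / b\<^sup>2) = - 1 / (b - 1)"
      using b by (simp add: divide_simps power2_eq_square) (simp add: algebra_simps)
    show ?thesis
      unfolding vv[OF yz(1,2)] using product by (elim disjE) (simp_all only: plus minus simp_thms)
  qed
  have f_values: "f (1 / (b + 1)) = - 1"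
  proof -
    define r where "r = b + 1"
    have r: "r \<noteq> 0" "b = r - 1" using b by (auto simp: r_def)
    show ?thesis unfolding f_def P_def Q_def r(2)
      using r(1) by (simp add: power2_eq_square power3_eq_cube field_simps)
  qed
  have f_values': "f (- 1 / (b - 1)) = - 1"
  proof -
    define r where "r = b - 1"
    have r: "r \<noteq> 0" "b = r + 1" using b by (auto simp: r_def)
    show ?thesis unfolding f_def P_def Q_def r(2)
      using r(1) by (simp add: power2_eq_square power3_eq_cube field_simps)
  qed
  \<comment> \<open>\<open>f 1 = P - Q\<close>, so the diagonal exceeds the constant value
    \<open>- 1\<close> by \<open>P - Q + 1\<close>.\<close>
  have f: "f (v y \<bullet> v z) = (if y = z then P - Q + 1 else 0) - 1" if "y \<in> ?I" "z \<in> ?I" for y z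
  proof (cases "y = z")
    case True
    then show ?thesis using unit[OF that(1)] by (simp add: f_def)
  next
    case False
    then have "f (v y \<bullet> v z) = - 1" using inner_values[OF that False] f_values f_values' by (elim disjE; simp only:)
    then show ?thesis using False by simp
  qed
  have ss: "(\<Sum>y\<in>?I. \<Sum>z\<in>?I. v y \<bullet> v z) = s \<bullet> s"
    unfolding s_def by (simp only: inner_sum_left, simp only: inner_sum_right)
  have M: "real (card ?I) = ?M" using x finite_X by simp
  have "(\<Sum>y\<in>?I. \<Sum>z\<in>?I. f (v y \<bullet> v z)) = ?M * (P - Q + 1) - ?M * ?M"
  proof -
    have "(\<Sum>y\<in>?I. \<Sum>z\<in>?I. f (v y \<bullet> v z)) = (\<Sum>y\<in>?I. \<Sum>z\<in>?I. (if y = z then P - Q + 1 else 0) - 1)"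
      by (intro sum.cong refl f)
    also have "\<dots> = ?M * (P - Q + 1) - ?M * ?M"
      using finite_X x by (simp add: sum_subtractf right_diff_distrib)
    finally show ?thesis .
  qed
  \<comment> \<open>Split \<open>f\<close> into a Gegenbauer part of degree 3, whose sum is
    nonnegative, and a linear part, whose sum is a multiple of \<open>s \<bullet> s\<close>.\<close>
  moreover have "(\<Sum>y\<in>?I. \<Sum>z\<in>?I. f (v y \<bullet> v z))
     = P * (\<Sum>y\<in>?I. \<Sum>z\<in>?I. (v y \<bullet> v z) ^ 3 - k * (v y \<bullet> v z)) + (P * k - Q) * (s \<bullet> s)"
  proof -
    have "f w = P * (w ^ 3 - k * w) + (P * k - Q) * w" for w
      by (simp add: f_def algebra_simps)
    then show ?thesis unfolding ss[symmetric] by (simp only: sum.distrib sum_distrib_left)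
  qed
  moreover have "0 \<le> P * (\<Sum>y\<in>?I. \<Sum>z\<in>?I. (v y \<bullet> v z) ^ 3 - k * (v y \<bullet> v z))"
    unfolding k_def by (intro mult_nonneg_nonneg sum_cubic_harmonic_nonneg unit) (auto simp: P_def)
  ultimately have "(P * k - Q) * (s \<bullet> s) \<le> ?M * (P - Q + 1 - ?M)"
    by (simp add: right_diff_distrib)
  also have "P - Q + 1 - ?M = (b\<^sup>2 - 1) * (b\<^sup>2 - 2) / 2 - card X"
  proof -
    have "card X \<ge> 1" using x finite_X by (auto simp: Suc_le_eq card_gt_0_iff)
    then have "?M = real (card X) - 1" by simp
    then show ?thesis by (simp add: P_def Q_def power2_eq_square field_simps)
  qed
  finally show ?thesis unfolding P_def Q_def k_def .
qed

text \<open>The first hypothesis says that the coefficient of \<open>s \<bullet> s\<close> in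
  \<open>derived_set_bound\<close> is nonnegative.\<close>

lemma cubic_bound:
  assumes "(real CARD('n) + 2) * (b\<^sup>2 + 3) \<le> 3 * (b\<^sup>2 - 1)\<^sup>2" "card X \<ge> 2"
  shows "card X \<le> (b\<^sup>2 - 1) * (b\<^sup>2 - 2) / 2"
proof -
  obtain x where x: "x \<in> X" using assms(2) by fastforce
  have "0 \<le> (b\<^sup>2 - 1)\<^sup>2 / 2 * (3 / (real CARD('n) + 2)) - (b\<^sup>2 + 3) / 2"
    using assms(1) by (simp add: field_simps)
  then have "0 \<le> (card X - 1) * ((b\<^sup>2 - 1) * (b\<^sup>2 - 2) / 2 - card X)"
    using derived_set_bound[OF x] by (meson inner_ge_zero mult_nonneg_nonneg order_trans)
  then show ?thesis using assms(2) by (simp add: zero_le_mult_iff)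
qed

text \<open>Now that coefficient is positive and the right side of \<open>derived_set_bound\<close>
  is 0, so \<open>s = 0\<close> for every \<open>x\<close>. Unwound, this makes each
  \<open>x\<close> an eigenvector of the frame operator with the common eigenvalue
  \<open>(b\<^sup>2 - 1) / 2\<close>.\<close>

lemma dim_cubic_bound_eq:
  assumes "(real CARD('n) + 2) * (b\<^sup>2 + 3) < 3 * (b\<^sup>2 - 1)\<^sup>2"
    and eq: "card X = (b\<^sup>2 - 1) * (b\<^sup>2 - 2) / 2"
  shows "dim X = b\<^sup>2 - 2"
proof -
  define c where "c = 1 / sqrt (1 - 1 / b\<^sup>2)"
  have b: "b > 1" "b\<^sup>2 > 1" "b\<^sup>2 \<noteq> 1" using b_gt_1 by (auto simp: power2_eq_1_iff)
  have "c \<noteq> 0" using b by (simp add: c_def)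
  have "(\<Sum>y\<in>X. (x \<bullet> y) *\<^sub>R y) = ((b\<^sup>2 - 1) / 2) *\<^sub>R x" if x: "x \<in> X" for x
  proof -
    define s where "s = (\<Sum>y\<in>X-{x}. c *\<^sub>R ((b * (x \<bullet> y)) *\<^sub>R y - (1 / b) *\<^sub>R x))"
    have "card X \<ge> 1" using x finite_X by (auto simp: Suc_le_eq card_gt_0_iff)
    then have M: "real (card (X - {x})) = (b\<^sup>2 - 1) * (b\<^sup>2 - 2) / 2 - 1" using x finite_X eq by simp
    have "0 < (b\<^sup>2 - 1)\<^sup>2 / 2 * (3 / (real CARD('n) + 2)) - (b\<^sup>2 + 3) / 2"
      using assms(1) by (simp add: field_simps)
    moreover have "((b\<^sup>2 - 1)\<^sup>2 / 2 * (3 / (real CARD('n) + 2)) - (b\<^sup>2 + 3) / 2) * (s \<bullet> s) \<le> 0"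
      using derived_set_bound[OF x] eq unfolding s_def c_def by simp
    ultimately have "s \<bullet> s \<le> 0" by (simp add: mult_le_0_iff)
    then have "s = 0" by (metis inner_gt_zero_iff not_le)
    then have "(\<Sum>y\<in>X-{x}. (b * (x \<bullet> y)) *\<^sub>R y - (1 / b) *\<^sub>R x) = 0"
      using \<open>c \<noteq> 0\<close> by (simp add: s_def flip: scaleR_right.sum)
    then have "b *\<^sub>R (\<Sum>y\<in>X-{x}. (x \<bullet> y) *\<^sub>R y) = (card (X - {x}) * (1 / b)) *\<^sub>R x"
      by (simp add: sum_subtractf scaleR_right.sum sum_constant_scaleR del: sum_constant)
    then have "(1 / b) *\<^sub>R (b *\<^sub>R (\<Sum>y\<in>X-{x}. (x \<bullet> y) *\<^sub>R y)) = (1 / b) *\<^sub>R ((card (X - {x}) * (1 / b)) *\<^sub>R x)"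
      by simp
    then have "(\<Sum>y\<in>X-{x}. (x \<bullet> y) *\<^sub>R y) = (((b\<^sup>2 - 1) * (b\<^sup>2 - 2) / 2 - 1) / b\<^sup>2) *\<^sub>R x"
      using b unfolding M by (simp add: power2_eq_square)
    then have "(\<Sum>y\<in>X. (x \<bullet> y) *\<^sub>R y) = (1 + ((b\<^sup>2 - 1) * (b\<^sup>2 - 2) / 2 - 1) / b\<^sup>2) *\<^sub>R x"
      unfolding sum.remove[OF finite_X x] norm_X[OF x] scaleR_left_distrib by simp
    also have "1 + ((b\<^sup>2 - 1) * (b\<^sup>2 - 2) / 2 - 1) / b\<^sup>2 = (b\<^sup>2 - 1) / 2"
      using b by (simp add: field_simps power2_eq_square)
    finally show ?thesis .
  qed
  then have "(b\<^sup>2 - 1) / 2 * dim X = card X"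
    by (intro dim_span_tight_frame finite_X norm_X)
  then have "(b\<^sup>2 - 1) / 2 * dim X = (b\<^sup>2 - 1) / 2 * (b\<^sup>2 - 2)" using eq by simp
  then show ?thesis using b by simp
qed

end

section \<open>Exclusion of every odd \<open>b\<close> other than \<open>a\<close>, and the equality
  case\<close>

theorem corollary1:
  fixes X :: "(real ^ 'n) set" and a :: nat
  assumes "CARD('n) \<ge> 359"
    and "a > 0" and "odd a"
    and "(int a)\<^sup>2 - 2 \<le> int CARD('n)"
    and "int CARD('n) \<le> (int a + 2)\<^sup>2 - 3"
    and "equiangular_set X"
    and "real (card X) = ((real a)\<^sup>2 - 2) * ((real a)\<^sup>2 - 1) / 2"
  shows "(\<forall>x\<in>X. \<forall>y\<in>X. x \<noteq> y \<longrightarrow> x \<bullet> y \<in> {1 / real a, - (1 / real a)}) \<and>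
         (\<exists>S :: (real ^ 'n) set. subspace S \<and> dim S = a\<^sup>2 - 2 \<and> X \<subseteq> S)"
proof -
  define n where "n = real CARD('n)"
  define N where "N = real (card X)"
  \<comment> \<open>The threshold 359: an odd \<open>a\<close> below 19 is at most 17, which gives a
    dimension of at most 358.\<close>
  have a19: "a \<ge> 19"
  proof (rule ccontr)
    assume "\<not> a \<ge> 19"
    moreover have "a \<noteq> 18" using \<open>odd a\<close> by auto
    ultimately have "int a + 2 \<le> 19" by simp
    then have "(int a + 2)\<^sup>2 \<le> 19\<^sup>2" by (intro power_mono) auto
    then show False using assms(1,5) by simp
  qed
  \<comment> \<open>After this shift each polynomial inequality in \<open>a\<close> has nonnegative
    coefficients in \<open>t\<close>; the numbers given to \<open>polynomial_pos\<close> are the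
    coefficients of the difference of its sides, doubled where \<open>N\<close> occurs.\<close>
  define t where "t = real a - 19"
  have t: "t \<ge> 0" "real a = t + 19" using a19 by (auto simp: t_def)
  have polynomial_pos: "0 < c0 + c1 * t + c2 * t\<^sup>2 + c3 * t ^ 3 + c4 * t ^ 4"
    if "c0 > 0" "c1 \<ge> 0" "c2 \<ge> 0" "c3 \<ge> 0" "c4 \<ge> 0" for c0 c1 c2 c3 c4 :: real
    using that t(1) by (intro add_pos_nonneg) auto
  have n_le: "n \<le> (real a + 2)\<^sup>2 - 3"
  proof -
    have "real_of_int (int CARD('n)) \<le> real_of_int ((int a + 2)\<^sup>2 - 3)" using assms(5) by (simp only: of_int_le_iff)
    then show ?thesis by (simp add: n_def)
  qed
  have n_ge: "359 \<le> n" using assms(1) by (simp add: n_def)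
  have N: "N = ((real a)\<^sup>2 - 2) * ((real a)\<^sup>2 - 1) / 2" using assms(7) by (simp add: N_def)
  \<comment> \<open>62 is what the case \<open>b \<le> 5\<close> needs: there
    \<open>N / 4 \<le> n * (31 / 2)\<close> is to be refuted.\<close>
  have N_62: "N > 62 * n"
  proof -
    have "62 * n \<le> 62 * ((real a + 2)\<^sup>2 - 3)" using n_le by simp
    also have "\<dots> < N" unfolding N t
      using polynomial_pos[of 74928 22114 2039 76 1] by (simp add: eval_nat_numeral algebra_simps)
    finally show ?thesis .
  qed
  \<comment> \<open>The relative bound fails in the extreme case \<open>b = a + 2\<close>,
    \<open>n = (a + 2)\<^sup>2 - 3\<close>, where the factor \<open>(a + 2)\<^sup>2 - n\<close> is
    3.\<close>
  have N_relative: "((real a + 2)\<^sup>2 - 3) * ((real a + 2)\<^sup>2 - 1) < 3 * N"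
    unfolding N t using polynomial_pos[of 2280 8214 1205 60 1] by (simp add: eval_nat_numeral algebra_simps)
  have N_small: "6 * ((real a + 2)\<^sup>2 - 3) * ((real a + 2)\<^sup>2 + 32) < 25 * N"
    unfolding N t using polynomial_pos[of 744912 223906 21975 892 13] by (simp add: eval_nat_numeral algebra_simps)
  obtain \<alpha> where fin: "finite X" and unit: "\<And>x. x \<in> X \<Longrightarrow> x \<bullet> x = 1" and \<alpha>: "0 \<le> \<alpha>" "\<alpha> < 1"
    and inner: "\<And>x y. x \<in> X \<Longrightarrow> y \<in> X \<Longrightarrow> x \<noteq> y \<Longrightarrow> x \<bullet> y = \<alpha> \<or> x \<bullet> y = - \<alpha>"
    using assms(6) unfolding equiangular_set_def by (auto simp: norm_eq_1 subset_iff)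
  have "\<alpha> \<noteq> 0"
  proof
    assume "\<alpha> = 0"
    then have "pairwise Linear_Algebra.orthogonal X"
      using inner by (fastforce simp: pairwise_def Linear_Algebra.orthogonal_def)
    moreover have "0 \<notin> X" using unit by force
    ultimately have "independent X" by (rule pairwise_orthogonal_independent)
    then have "card X \<le> DIM(real ^ 'n)" by (rule independent_card_le)
    then have "N \<le> n" by (simp add: N_def n_def)
    then show False using N_62 n_ge by simp
  qed
  define b where "b = 1 / \<alpha>"
  interpret equiangular_lines X b
    using fin unit inner \<alpha> \<open>\<alpha> \<noteq> 0\<close> by unfold_locales (auto simp: b_def)
  have "card X > 2 * CARD('n)" using N_62 n_ge by (simp add: N_def n_def)
  then obtain k :: int where k: "b = of_int k" "odd k" by (rule odd_inverse_angle)
  have "k > 1" using b_gt_1 k(1) by simp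
  then have "k \<ge> 3" using k(2) by presburger
  then have "b \<ge> 3" using k(1) by simp
  have "b = a"
  proof (rule ccontr)
    assume "b \<noteq> a"
    then consider "k \<ge> int a + 1" | "k \<le> int a - 1" using k(1) by fastforce
    then show False
    proof cases
      case 1
      then have "k \<ge> int a + 2" using k(2) assms(3) by presburger
      then have "b \<ge> real a + 2" unfolding k(1) by linarith
      then have b2: "b\<^sup>2 \<ge> (real a + 2)\<^sup>2" by (intro power_mono) auto
      \<comment> \<open>The relative bound reads
        \<open>b\<^sup>2 * (N - n) \<le> n * (N - 1)\<close>; since \<open>N > n\<close>,
        \<open>b\<close> may be lowered to \<open>a + 2\<close>.\<close>
      have "(real a + 2)\<^sup>2 * (N - n) \<le> b\<^sup>2 * (N - n)"
        using b2 N_62 n_ge by (intro mult_right_mono) auto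
      moreover have "N * (b\<^sup>2 - n) \<le> n * (b\<^sup>2 - 1)"
        using relative_bound by (simp add: N_def n_def)
      ultimately have "N * ((real a + 2)\<^sup>2 - n) \<le> n * ((real a + 2)\<^sup>2 - 1)"
        by (simp add: algebra_simps)
      also have "\<dots> \<le> ((real a + 2)\<^sup>2 - 3) * ((real a + 2)\<^sup>2 - 1)"
        using n_le n_ge by (intro mult_right_mono) auto
      also have "\<dots> < N * 3" using N_relative by simp
      also have "\<dots> \<le> N * ((real a + 2)\<^sup>2 - n)"
        using n_le N_62 n_ge by (intro mult_left_mono) auto
      finally show False by simp
    next
      case 2
      then have "b \<le> real a - 1" unfolding k(1) by linarith
      show False
      \<comment> \<open>Where the cubic bound applies, it lies below its value at \<open>a\<close>,
        which is \<open>N\<close>. Otherwise \<open>b\<^sup>2\<close> is less than about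
        \<open>n / 3\<close>.\<close>
      proof (cases "(n + 2) * (b\<^sup>2 + 3) \<le> 3 * (b\<^sup>2 - 1)\<^sup>2")
        case True
        have "card X \<ge> 2" using N_62 n_ge by (simp add: N_def)
        with True have "N \<le> (b\<^sup>2 - 1) * (b\<^sup>2 - 2) / 2"
          using cubic_bound by (simp add: N_def n_def)
        also have "\<dots> < N"
        proof -
          have "b\<^sup>2 \<ge> 3\<^sup>2" using \<open>b \<ge> 3\<close> by (intro power_mono) auto
          moreover have "b\<^sup>2 < (real a)\<^sup>2" using \<open>b \<le> real a - 1\<close> \<open>b \<ge> 3\<close> by (intro power_strict_mono) auto
          ultimately have "(b\<^sup>2 - 1) * (b\<^sup>2 - 2) < ((real a)\<^sup>2 - 1) * ((real a)\<^sup>2 - 2)"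
            by (intro mult_strict_mono) auto
          then show ?thesis unfolding N by (simp add: mult.commute)
        qed
        finally show False by simp
      next
        case False
        have "(b\<^sup>2 - 5) * (b\<^sup>2 + 3) \<le> (b\<^sup>2 - 1)\<^sup>2"
          by (simp add: power2_eq_square algebra_simps)
        with False have "3 * ((b\<^sup>2 - 5) * (b\<^sup>2 + 3)) < (n + 2) * (b\<^sup>2 + 3)" by linarith
        then have "3 * (b\<^sup>2 - 5) * (b\<^sup>2 + 3) < (n + 2) * (b\<^sup>2 + 3)" by (simp only: mult.assoc)
        moreover have "0 < b\<^sup>2 + 3" by (simp add: add_nonneg_pos)
        ultimately have "3 * (b\<^sup>2 - 5) < n + 2" using mult_less_cancel_right_pos by blast
        then have b2: "b\<^sup>2 < (n + 17) / 3" by simp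
        then have "b\<^sup>2 / N \<le> 1" using N_62 n_ge by simp
        show False
        proof (cases "k \<ge> 7")
          case True
          then have "b \<ge> 7" using k(1) by simp
          then have "b\<^sup>2 \<ge> 7\<^sup>2" by (intro power_mono) auto
          then have "N / b\<^sup>2 \<le> N / 7\<^sup>2" using N_62 n_ge by (intro divide_left_mono) auto
          \<comment> \<open>\<open>t = 1 / 6\<close> is admissible because 1/49 < 1/36, with room
            for the summand 1.\<close>
          then have "N / b\<^sup>2 + 1 \<le> (1 / 6)\<^sup>2 * N" using N_62 n_ge by (simp add: power2_eq_square)
          then have "(1 - 1 / 6)\<^sup>2 * N \<le> n * (b\<^sup>2 / 2 + 2 + b\<^sup>2 / N)"
            unfolding n_def using N_62 n_ge by (intro small_angle_bound) (auto simp: N_def)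
          also have "\<dots> \<le> n * ((n + 17) / 6 + 3)"
            using b2 \<open>b\<^sup>2 / N \<le> 1\<close> n_ge by (intro mult_left_mono; linarith)
          finally have "25 * N \<le> 6 * n * (n + 35)" by (simp add: power2_eq_square field_simps)
          also have "\<dots> \<le> 6 * ((real a + 2)\<^sup>2 - 3) * ((real a + 2)\<^sup>2 + 32)"
            using n_le n_ge by (intro mult_mono) auto
          finally show False using N_small by simp
        next
          case False
          then have "k \<le> 5" using k(2) by presburger
          then have "b \<le> 5" using k(1) by simp
          then have "b\<^sup>2 \<le> 5\<^sup>2" "b\<^sup>2 \<ge> 3\<^sup>2" using \<open>b \<ge> 3\<close> by (intro power_mono; simp)+
          then have "N / b\<^sup>2 \<le> N / 3\<^sup>2" using N_62 n_ge by (intro divide_left_mono) auto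
          \<comment> \<open>Only \<open>b = 3\<close> and \<open>b = 5\<close> remain; 1/9 < 1/4
            admits \<open>t = 1 / 2\<close>.\<close>
          then have "N / b\<^sup>2 + 1 \<le> (1 / 2)\<^sup>2 * N" using N_62 n_ge by (simp add: power2_eq_square)
          then have "(1 - 1 / 2)\<^sup>2 * N \<le> n * (b\<^sup>2 / 2 + 2 + b\<^sup>2 / N)"
            unfolding n_def using N_62 n_ge by (intro small_angle_bound) (auto simp: N_def)
          also have "\<dots> \<le> n * (31 / 2)"
          proof (rule mult_left_mono)
            have "b\<^sup>2 \<le> 25" using \<open>b\<^sup>2 \<le> 5\<^sup>2\<close> by simp
            then show "b\<^sup>2 / 2 + 2 + b\<^sup>2 / N \<le> 31 / 2" using \<open>b\<^sup>2 / N \<le> 1\<close> by linarith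
          qed (use n_ge in simp)
          finally show False using N_62 by (simp add: power2_eq_square)
        qed
      qed
    qed
  qed
  moreover have "\<alpha> = 1 / b" by (simp add: b_def)
  ultimately have "\<alpha> = 1 / a" by simp
  have "(n + 2) * (b\<^sup>2 + 3) < 3 * (b\<^sup>2 - 1)\<^sup>2"
  proof -
    have "(n + 2) * (b\<^sup>2 + 3) \<le> ((real a + 2)\<^sup>2 - 1) * (b\<^sup>2 + 3)"
      using n_le by (intro mult_right_mono) auto
    also have "\<dots> < 3 * (b\<^sup>2 - 1)\<^sup>2" unfolding \<open>b = a\<close> t
      using polynomial_pos[of 228640 50072 4092 148 2] by (simp add: eval_nat_numeral algebra_simps)
    finally show ?thesis .
  qed
  then have "dim X = b\<^sup>2 - 2"
    by (intro dim_cubic_bound_eq) (simp_all add: n_def N[unfolded N_def] \<open>b = a\<close> mult.commute)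
  \<comment> \<open>Adding 2 avoids the truncated subtraction when passing from reals to
    naturals.\<close>
  then have "real (dim X + 2) = real (a\<^sup>2)" by (simp add: \<open>b = a\<close>)
  then have "dim (span X) = a\<^sup>2 - 2" by (simp only: of_nat_eq_iff dim_span)
  then show ?thesis
    using inner \<open>\<alpha> = 1 / a\<close> span_superset[of X] subspace_span[of X] by blast
qed

end
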